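(* Let $n\ge 1$, let $A_1,\dots,A_{n+2}\in\mathbb{R}^n$ be points any $n+1$ of which are affinely independent, and let $\alpha_1,\dots,\alpha_{n+2}$ be non-zero real numbers with $\sum\alpha_i=0$ and $\sum\alpha_iA_i=0$. Let $f(x)=\sum_{i=0}^{n+1}(-1)^ic_i(\alpha^i)x^{n+1-i}$ be the characteristic polynomial of $(\mathbf{A},\alpha)$. Then the roots of $f(x)$ are real. Moreover, if exactly $s$ of the numbers $\alpha_1,\dots,\alpha_{n+2}$ are positive, then (counted with multiplicity) $f(x)$ has $1$ zero root, $s-1$ positive roots and $n+1-s$ negative roots.
   Context: Here $\mathbf{A}=\{A_1,\dots,A_{n+2}\}$. The invariants $c_k(\alpha^k)$ (Euclidean case) are: $c_0(\alpha^0)=1$, and for $1\le k\le n+1$, $$c_k(\alpha^k)=\sum_{F\subset\mathbf{A},\ \dim F=k-1}\Big(\prod_{A_s\in F}\alpha_s\Big)d_F(P,Q),$$ where the sum is over all $(k-1)$-simplices $F$ spanned by $k$ of the points, $P,Q\in\mathbb{R}^n$ are arbitrary (the value is independent of their choice), and for $F$ with vertices $B_1,\dots,B_k$, $$d_F(P,Q)=(\overrightarrow{PB_1}\wedge\cdots\wedge\overrightarrow{PB_k})\cdot(\overrightarrow{QB_1}\wedge\cdots\wedge\overrightarrow{QB_k})=\det\big(\overrightarrow{PB_i}\cdot\overrightarrow{QB_j}\big)_{1\le i,j\le k}.$$ *)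

theory Defs
  imports "HOL-Analysis.Analysis" "Jordan_Normal_Form.Determinant"
begin

definition any_affinely_independent :: "(nat \<Rightarrow> real^'n) \<Rightarrow> bool" where
  "any_affinely_independent A \<longleftrightarrow>
     (\<forall>I \<subseteq> {1..CARD('n) + 2}. card I = CARD('n) + 1 \<longrightarrow>
        inj_on A I \<and> \<not> affine_dependent (A ` I))"

text \<open>A simplex spanned by some of the points is given by the set \<open>I\<close> of the indices of its
  vertices. The vertices are enumerated by increasing index; the determinant does not depend on
  the enumeration. The constant \<open>det\<close> of \<open>HOL-Analysis\<close> does not serve here, since the size
  of the matrix varies.\<close>

definition simplex_det :: "(nat \<Rightarrow> real^'n) \<Rightarrow> real^'n \<Rightarrow> real^'n \<Rightarrow> nat set \<Rightarrow> real" where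
  "simplex_det A P Q I =
     (let B = map A (sorted_list_of_set I)
      in Determinant.det (mat (card I) (card I) (\<lambda>(i, j). inner (B ! i - P) (B ! j - Q))))"

text \<open>The sum ranges over all \<open>k\<close>-element sets of indices. If any \<open>n + 1\<close> of the points are
  affinely independent and \<open>k \<le> n + 1\<close>, these are exactly the \<open>(k - 1)\<close>-simplices spanned by
  \<open>k\<close> of the points. If moreover the weights and the weighted points both sum to zero, then the value does
  not depend on \<open>P\<close> and \<open>Q\<close>; these are therefore kept as arbitrary parameters.\<close>

definition invariant_c ::
    "(nat \<Rightarrow> real^'n) \<Rightarrow> (nat \<Rightarrow> real) \<Rightarrow> real^'n \<Rightarrow> real^'n \<Rightarrow> nat \<Rightarrow> real" where
  "invariant_c A \<alpha> P Q k =
     (if k = 0 then 1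
      else (\<Sum>I | I \<subseteq> {1..CARD('n) + 2} \<and> card I = k. (\<Prod>s\<in>I. \<alpha> s) * simplex_det A P Q I))"

definition characteristic_polynomial ::
    "(nat \<Rightarrow> real^'n) \<Rightarrow> (nat \<Rightarrow> real) \<Rightarrow> real^'n \<Rightarrow> real^'n \<Rightarrow> real poly" where
  "characteristic_polynomial A \<alpha> P Q =
     (\<Sum>i = 0..CARD('n) + 1. monom ((-1) ^ i * invariant_c A \<alpha> P Q i) (CARD('n) + 1 - i))"

end

(* The invariant c_k is the sum of the principal k-minors of the matrix
   (alpha_i (A_i - P).(A_j - Q)) of size n + 2, so x f(x) is its characteristic polynomial (whose
   constant term vanishes). The matrix factors as U V through R^n, and because the weights and the
   weighted points sum to zero, V U is the matrix of the self-adjoint operator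
   S v = sum_i alpha_i (A_i.v) A_i, whatever P and Q are. By Sylvester's identity, f(x) is x times
   the product of the x - ev b over the eigenvalues ev b of S. For the signs, the form
   sum_i alpha_i (A_i.v + c)^2 on R^n x R does not depend on c, and an affine function vanishing at
   all A_i is zero; a dimension count then bounds the number of negative and of positive
   eigenvalues from below, and these two bounds add up to n. *)

theory Submission
  imports Defs
begin

no_notation scalar_prod (infix \<open>\<bullet>\<close> 70)
hide_const (open) Matrix.orthogonal
hide_fact (open) Matrix.orthogonal_def

section \<open>Sylvester's determinant identity and Leibniz expansions over index sets\<close>

text \<open>Two block triangular multipliers, one on the left and one on the right, each clear the
  upper right block of the same matrix \<open>M\<close>; comparing determinants gives both sides.
  Powers of \<open>x\<close> take the place of a division, so \<open>x = 0\<close> is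
  covered.\<close>

lemma sylvester_det_identity:
  fixes x :: "'a::idom"
  assumes U: "U \<in> carrier_mat m n" and V: "V \<in> carrier_mat n m"
  shows "x ^ n * Determinant.det (x \<cdot>\<^sub>m 1\<^sub>m m - U * V) = x ^ m * Determinant.det (x \<cdot>\<^sub>m 1\<^sub>m n - V * U)"
proof -
  define M where "M = four_block_mat (x \<cdot>\<^sub>m 1\<^sub>m m) U V (1\<^sub>m n)"
  have M: "M \<in> carrier_mat (m + n) (m + n)"
    unfolding M_def by auto
  have L: "four_block_mat (1\<^sub>m m) (- U) (0\<^sub>m n m) (1\<^sub>m n) * M
      = four_block_mat (x \<cdot>\<^sub>m 1\<^sub>m m - U * V) (0\<^sub>m m n) V (1\<^sub>m n)"
    unfolding M_def using U V
    by (subst mult_four_block_mat[of _ m m _ n _ n _ _ m _ n])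
       (auto intro!: cong_four_block_mat simp: add_uminus_minus_mat)
  have R: "M * four_block_mat (1\<^sub>m m) (- U) (0\<^sub>m n m) (x \<cdot>\<^sub>m 1\<^sub>m n)
      = four_block_mat (x \<cdot>\<^sub>m 1\<^sub>m m) (0\<^sub>m m n) V (x \<cdot>\<^sub>m 1\<^sub>m n - V * U)"
    unfolding M_def using U V
    by (subst mult_four_block_mat[of _ m m _ n _ n _ _ m _ n])
       (auto intro!: cong_four_block_mat simp: mult_smult_distrib mult_smult_assoc_mat[of _ m m _ n] intro: eq_matI)
  let ?E = "four_block_mat (1\<^sub>m m) (- U) (0\<^sub>m n m)"
  have E: "?E D \<in> carrier_mat (m + n) (m + n)" "Determinant.det (?E D) = Determinant.det D" if "D \<in> carrier_mat n n" for D
    using U that det_four_block_mat_lower_left_zero[of "1\<^sub>m m" m "- U" n "0\<^sub>m n m" D] by auto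
  have carrier: "x \<cdot>\<^sub>m 1\<^sub>m m - U * V \<in> carrier_mat m m" "x \<cdot>\<^sub>m 1\<^sub>m n - V * U \<in> carrier_mat n n"
    using U V by (auto intro!: minus_carrier_mat)
  have "Determinant.det M = Determinant.det (?E (1\<^sub>m n) * M)"
    using det_mult[OF E(1) M] E(2) by simp
  also have "\<dots> = Determinant.det (x \<cdot>\<^sub>m 1\<^sub>m m - U * V)"
    unfolding L using det_four_block_mat_upper_right_zero[OF _ refl V, of "x \<cdot>\<^sub>m 1\<^sub>m m - U * V" "1\<^sub>m n"] carrier
    by simp
  finally have 1: "Determinant.det M = Determinant.det (x \<cdot>\<^sub>m 1\<^sub>m m - U * V)" .
  have "Determinant.det M * x ^ n = Determinant.det (M * ?E (x \<cdot>\<^sub>m 1\<^sub>m n))"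
    using det_mult[OF M E(1)] E(2) by simp
  also have "\<dots> = x ^ m * Determinant.det (x \<cdot>\<^sub>m 1\<^sub>m n - V * U)"
    unfolding R using det_four_block_mat_upper_right_zero[OF _ refl V, of "x \<cdot>\<^sub>m 1\<^sub>m m" "x \<cdot>\<^sub>m 1\<^sub>m n - V * U"] carrier
    by simp
  finally show ?thesis
    using 1 by (simp add: mult.commute)
qed

text \<open>Conjugation by the enumeration carries permutations of positions to permutations of the
  set and keeps signs. The order of \<open>xs\<close> drops out, so minors may be indexed by
  sets.\<close>

lemma det_mat_nth_leibniz:
  fixes M :: "'b \<Rightarrow> 'b \<Rightarrow> 'a::comm_ring_1"
  assumes "distinct xs"
  shows "Determinant.det (mat (length xs) (length xs) (\<lambda>(i, j). M (xs ! i) (xs ! j)))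
    = (\<Sum>p | p permutes set xs. of_int (sign p) * (\<Prod>i\<in>set xs. M i (p i)))"
proof -
  define f where "f = nth xs"
  define g where "g = inv_into {0..<length xs} f"
  let ?A = "{0..<length xs}"
  have f: "bij_betw f ?A (set xs)"
    unfolding f_def using bij_betw_nth[OF assms] by (simp add: lessThan_atLeast0)
  then have g: "bij_betw g (set xs) ?A"
    unfolding g_def by (rule bij_betw_inv_into)
  have inj: "inj_on f ?A"
    using f by (rule bij_betw_imp_inj_on)
  have gf: "g (f i) = i" if "i \<in> ?A" for i
    unfolding g_def using inj that by (rule inv_into_f_f)
  have fg: "f (g y) = y" if "y \<in> set xs" for y
    unfolding g_def using f that by (rule bij_betw_inv_into_right)
  have "(\<Sum>p | p permutes ?A. of_int (sign p) * (\<Prod>i\<in>?A. M (f i) (f (p i))))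
      = (\<Sum>p | p permutes set xs. of_int (sign p) * (\<Prod>i\<in>set xs. M i (p i)))"
  proof (rule sum.reindex_bij_witness[of _ "map_permutation (set xs) g" "map_permutation ?A f"])
    fix p assume "p \<in> {p. p permutes ?A}"
    then have p: "p permutes ?A" by simp
    show "map_permutation (set xs) g (map_permutation ?A f p) = p"
      by (rule map_permutation_compose_inv[OF f p gf])
    show "map_permutation ?A f p \<in> {p. p permutes set xs}"
      using map_permutation_permutes[OF f p] by simp
    have "(\<Prod>i\<in>set xs. M i (map_permutation ?A f p i)) = (\<Prod>i\<in>?A. M (f i) (f (p i)))"
      by (subst prod.reindex_bij_betw[OF f, symmetric])
         (intro prod.cong refl, simp add: map_permutation_apply[OF inj])
    then show "of_int (sign (map_permutation ?A f p)) * (\<Prod>i\<in>set xs. M i (map_permutation ?A f p i))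
        = of_int (sign p) * (\<Prod>i\<in>?A. M (f i) (f (p i)))"
      using sign_map_permutation[OF inj p] by simp
  next
    fix p assume "p \<in> {p. p permutes set xs}"
    then have p: "p permutes set xs" by simp
    show "map_permutation ?A f (map_permutation (set xs) g p) = p"
      by (rule map_permutation_compose_inv[OF g p fg])
    show "map_permutation (set xs) g p \<in> {p. p permutes ?A}"
      using map_permutation_permutes[OF g p] by simp
  qed
  moreover have "p i < length xs" if "p permutes ?A" "i \<in> ?A" for p i
    using permutes_in_image[OF that(1), of i] that(2) by simp
  ultimately show ?thesis
    by (subst det_def'[of _ "length xs"]) (auto simp: f_def intro!: sum.cong prod.cong)
qed

lemma permutes_fixing_complement:
  assumes "I \<subseteq> S"
  shows "{p. p permutes S \<and> (\<forall>i\<in>S - I. p i = i)} = {p. p permutes I}"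
  using assms by (auto intro: permutes_superset permutes_subset simp: permutes_not_in)

text \<open>Expanding the product chooses the set \<open>I\<close> of factors from which the entry
  of \<open>M\<close> is taken. Every other factor vanishes unless \<open>p\<close> fixes its index,
  so only permutations of \<open>I\<close> survive: det(M + x) becomes a sum over principal
  minors.\<close>

lemma leibniz_sum_plus_diagonal:
  fixes M :: "'b \<Rightarrow> 'b \<Rightarrow> 'a::comm_ring_1"
  assumes "finite S"
  shows "(\<Sum>p | p permutes S. of_int (sign p) * (\<Prod>i\<in>S. M i (p i) + (if p i = i then x else 0)))
    = (\<Sum>I\<in>Pow S. x ^ (card S - card I) * (\<Sum>p | p permutes I. of_int (sign p) * (\<Prod>i\<in>I. M i (p i))))"
proof -
  have diag: "(\<Prod>i\<in>S - I. if p i = i then x else 0)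
      = (if \<forall>i\<in>S - I. p i = i then x ^ (card S - card I) else 0)" if "I \<subseteq> S" for p I
  proof (cases "\<forall>i\<in>S - I. p i = i")
    case True
    then show ?thesis using assms that by (simp add: card_Diff_subset finite_subset)
  next
    case False
    then show ?thesis using assms by (auto intro!: prod_zero)
  qed
  have "(\<Sum>p | p permutes S. of_int (sign p) * (\<Prod>i\<in>S. M i (p i) + (if p i = i then x else 0)))
    = (\<Sum>I\<in>Pow S. \<Sum>p | p permutes S. of_int (sign p) *
        ((\<Prod>i\<in>I. M i (p i)) * (\<Prod>i\<in>S - I. if p i = i then x else 0)))"
    by (subst sum.swap) (simp add: prod_add[OF assms] sum_distrib_left)
  also have "\<dots> = (\<Sum>I\<in>Pow S. x ^ (card S - card I) *
        (\<Sum>p | p permutes I. of_int (sign p) * (\<Prod>i\<in>I. M i (p i))))"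
  proof (intro sum.cong refl)
    fix I assume "I \<in> Pow S"
    then have I: "I \<subseteq> S" by simp
    then have card_I: "card (S - I) = card S - card I"
      using assms by (simp add: card_Diff_subset finite_subset)
    have "(\<Sum>p | p permutes S. of_int (sign p) *
        ((\<Prod>i\<in>I. M i (p i)) * (\<Prod>i\<in>S - I. if p i = i then x else 0)))
      = (\<Sum>p | p permutes S \<and> (\<forall>i\<in>S - I. p i = i).
          x ^ (card S - card I) * (of_int (sign p) * (\<Prod>i\<in>I. M i (p i))))"
      using finite_permutations[OF assms]
      by (intro sum.mono_neutral_cong_right) (auto simp: diag[OF I] card_I ac_simps)
    then show "(\<Sum>p | p permutes S. of_int (sign p) *
        ((\<Prod>i\<in>I. M i (p i)) * (\<Prod>i\<in>S - I. if p i = i then x else 0)))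
      = x ^ (card S - card I) * (\<Sum>p | p permutes I. of_int (sign p) * (\<Prod>i\<in>I. M i (p i)))"
      by (simp add: permutes_fixing_complement[OF I] sum_distrib_left)
  qed
  finally show ?thesis .
qed

section \<open>Spectral theorem for self-adjoint operators\<close>

text \<open>Serves as the first-order condition at a maximum: a linear term would dominate near
  \<open>t = 0\<close>.\<close>

lemma nonneg_quadratic_imp_zero:
  fixes a b :: real
  assumes "\<And>t. 0 \<le> 2 * t * a + t\<^sup>2 * b"
  shows "a = 0"
proof (rule ccontr)
  assume a: "a \<noteq> 0"
  \<comment> \<open>At \<open>t = - a / k\<close> the quadratic equals a^2 (b - 2 k) / k^2; this
    \<open>k\<close> is positive and exceeds b / 2.\<close>
  define k where "k = \<bar>b\<bar> + 1"
  have k: "k > 0" "b < 2 * k"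
    by (auto simp: k_def)
  have "0 \<le> k\<^sup>2 * (2 * (- a / k) * a + (- a / k)\<^sup>2 * b)"
    by (rule mult_nonneg_nonneg[OF zero_le_power2 assms])
  also have "\<dots> = a\<^sup>2 * (b - 2 * k)"
    using k(1) by (simp add: field_simps power2_eq_square)
  also have "\<dots> < 0"
    using a k(2) by (intro mult_pos_neg) auto
  finally show False by simp
qed

text \<open>A maximiser \<open>u\<close> of v . f v on the compact unit sphere of \<open>V\<close>
  works: varying \<open>u\<close> inside \<open>V\<close> shows that the residual \<mu> u - f u is
  orthogonal to \<open>V\<close>, while invariance puts it into \<open>V\<close>.\<close>

lemma selfadjoint_eigenvector_exists:
  fixes f :: "'a::euclidean_space \<Rightarrow> 'a"
  assumes f: "linear f" and adj: "\<And>v w. f v \<bullet> w = v \<bullet> f w"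
    and V: "subspace V" "f ` V \<subseteq> V" "V \<noteq> {0}"
  obtains u \<mu> where "u \<in> V" "norm u = 1" "f u = \<mu> *\<^sub>R u"
proof -
  let ?K = "V \<inter> sphere 0 1"
  have "compact ?K"
    using closed_subspace[OF V(1)] by (simp add: closed_Int_compact)
  moreover obtain w where w: "w \<in> V" "w \<noteq> 0"
    using V subspace_0 by blast
  then have "w /\<^sub>R norm w \<in> ?K"
    using V(1) by (simp add: subspace_scale)
  then have "?K \<noteq> {}"
    by blast
  moreover have "continuous_on ?K (\<lambda>v. v \<bullet> f v)"
    using f by (intro continuous_on_inner continuous_on_id linear_continuous_on)
      (simp add: linear_conv_bounded_linear)
  ultimately obtain u where u: "u \<in> ?K" and max: "\<And>v. v \<in> ?K \<Longrightarrow> v \<bullet> f v \<le> u \<bullet> f u"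
    using continuous_attains_sup[of ?K "\<lambda>v. v \<bullet> f v"] by blast
  define \<mu> where "\<mu> = u \<bullet> f u"
  have uu: "u \<bullet> u = 1"
    using u by (simp add: dot_square_norm)
  \<comment> \<open>By homogeneity the maximum on the sphere bounds the form on all of
    \<open>V\<close>.\<close>
  have le: "v \<bullet> f v \<le> \<mu> * (v \<bullet> v)" if "v \<in> V" for v
  proof (cases "v = 0")
    case False
    then have "v /\<^sub>R norm v \<in> ?K"
      using that V(1) by (simp add: subspace_scale)
    from max[OF this] have "(v \<bullet> f v) / (norm v * norm v) \<le> \<mu>"
      by (simp add: linear_scale[OF f] divide_inverse mult_ac flip: \<mu>_def)
    then show ?thesis
      using False by (simp add: divide_le_eq dot_square_norm power2_eq_square)
  qed (simp add: linear_0[OF f])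
  have "(\<mu> *\<^sub>R u - f u) \<bullet> w = 0" if w: "w \<in> V" for w
  proof -
    let ?a = "(\<mu> *\<^sub>R u - f u) \<bullet> w" and ?b = "\<mu> * (w \<bullet> w) - w \<bullet> f w"
    \<comment> \<open>This is \<open>le\<close> at u + t w: the constant terms cancel because
      \<open>u\<close> attains the maximum, and self-adjointness merges the two cross terms.\<close>
    have "0 \<le> 2 * t * ?a + t\<^sup>2 * ?b" for t
    proof -
      have "u + t *\<^sub>R w \<in> V"
        using u w V(1) by (simp add: subspace_add subspace_scale)
      moreover have "u \<bullet> f w = f u \<bullet> w" "w \<bullet> f u = f u \<bullet> w" "u \<bullet> f u = \<mu>" "w \<bullet> u = u \<bullet> w"
        using adj[of u w] by (simp_all add: inner_commute \<mu>_def)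
      ultimately show ?thesis
        using le[of "u + t *\<^sub>R w"] uu
        by (simp add: linear_add[OF f] linear_scale[OF f] inner_simps power2_eq_square algebra_simps)
    qed
    then show "?a = 0"
      by (rule nonneg_quadratic_imp_zero)
  qed
  moreover have "\<mu> *\<^sub>R u - f u \<in> V"
    using u V by (auto intro: subspace_diff subspace_scale)
  ultimately have "\<mu> *\<^sub>R u - f u = 0"
    by (metis inner_eq_zero_iff)
  then show thesis
    using u that[of u \<mu>] by simp
qed

text \<open>Induction by splitting off one eigenvector; self-adjointness keeps its complement in
  \<open>V\<close> invariant. The statement ranges over invariant subspaces so that the induction
  hypothesis applies to that complement.\<close>

lemma selfadjoint_eigenbasis_subspace:
  fixes f :: "'a::euclidean_space \<Rightarrow> 'a"
  assumes f: "linear f" and adj: "\<And>v w. f v \<bullet> w = v \<bullet> f w"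
  shows "subspace V \<Longrightarrow> f ` V \<subseteq> V \<Longrightarrow> dim V = n \<Longrightarrow>
    \<exists>B ev. B \<subseteq> V \<and> finite B \<and> card B = n \<and> pairwise orthogonal B \<and> (\<forall>b\<in>B. norm b = 1 \<and> f b = ev b *\<^sub>R b)"
proof (induction n arbitrary: V)
  case 0
  show ?case by (intro exI[of _ "{}"]) simp
next
  case (Suc n)
  have "V \<noteq> {0}"
    using Suc.prems(3) by auto
  then obtain u \<mu> where u: "u \<in> V" "norm u = 1" "f u = \<mu> *\<^sub>R u"
    using selfadjoint_eigenvector_exists[OF f adj Suc.prems(1,2)] by blast
  define W where "W = {y \<in> V. \<forall>x \<in> span {u}. orthogonal x y}"
  have W: "W = {y \<in> V. u \<bullet> y = 0}"
    unfolding W_def by (auto simp: orthogonal_def span_singleton)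
  have subspace_W: "subspace W"
    using Suc.prems(1) unfolding W subspace_def by (auto simp: inner_simps)
  have f_W: "f ` W \<subseteq> W"
    using Suc.prems(2) u(3) unfolding W by (auto simp flip: adj)
  have dim_W: "dim W = n"
  proof -
    have "dim W + dim (span {u}) = dim V"
      unfolding W_def using Suc.prems(1) u(1)
      by (intro dim_subspace_orthogonal_to_vectors) (auto simp: span_minimal)
    moreover have "dim (span {u}) = 1"
      using u(2) by (subst dim_span, subst dim_singleton) auto
    ultimately show ?thesis using Suc.prems(3) by simp
  qed
  obtain B ev where B: "B \<subseteq> W" "finite B" "card B = n" "pairwise orthogonal B"
      "\<forall>b\<in>B. norm b = 1 \<and> f b = ev b *\<^sub>R b"
    using Suc.IH[OF subspace_W f_W dim_W] by blast
  \<comment> \<open>This makes \<open>insert u B\<close> one element larger and lets the update of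
    \<open>ev\<close> at \<open>u\<close> leave the eigenvalues on \<open>B\<close> intact.\<close>
  have "u \<notin> W"
    using u(2) unfolding W by auto
  then have "u \<notin> B"
    using B(1) by blast
  then show ?case
    using B u unfolding W
    by (intro exI[of _ "insert u B"] exI[of _ "ev(u := \<mu>)"])
       (auto simp: pairwise_insert orthogonal_def[abs_def] inner_commute)
qed

text \<open>Eigenvalues are attached to basis vectors, so an eigenvalue of multiplicity m occurs as
  \<open>ev b\<close> for m vectors \<open>b\<close>, and signs can be counted by cardinalities in
  \<open>B\<close>.\<close>

lemma selfadjoint_eigenbasis:
  fixes f :: "'a::euclidean_space \<Rightarrow> 'a"
  assumes "linear f" and "\<And>v w. f v \<bullet> w = v \<bullet> f w"
  obtains B ev where "finite B" "card B = DIM('a)"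
    "\<And>b c. b \<in> B \<Longrightarrow> c \<in> B \<Longrightarrow> b \<bullet> c = (if b = c then 1 else 0)"
    "\<And>b. b \<in> B \<Longrightarrow> f b = ev b *\<^sub>R b"
    "\<And>v. (\<Sum>b\<in>B. (v \<bullet> b) *\<^sub>R b) = v"
proof -
  obtain B ev where B: "finite B" "card B = DIM('a)" "pairwise orthogonal B"
      "\<forall>b\<in>B. norm b = 1 \<and> f b = ev b *\<^sub>R b"
    using selfadjoint_eigenbasis_subspace[OF assms, of UNIV] by auto
  have orthonormal: "b \<bullet> c = (if b = c then 1 else 0)" if "b \<in> B" "c \<in> B" for b c
    using B that by (auto simp: pairwise_def orthogonal_def dot_square_norm)
  have "0 \<notin> B"
    using B(4) by auto
  then have "independent B"
    using B(3) by (rule pairwise_orthogonal_independent[rotated])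
  then have span: "span B = UNIV"
    using B(1,2) by (metis dim_eq_card_independent dim_eq_full)
  have "(\<Sum>b\<in>B. (v \<bullet> b) *\<^sub>R b) = v" for v
  proof -
    \<comment> \<open>The residual of the expansion lies in the span of \<open>B\<close> and is
      orthogonal to \<open>B\<close>, hence to itself.\<close>
    have "v - (\<Sum>b\<in>B. (v \<bullet> b) *\<^sub>R b) \<in> span B"
      by (simp add: span)
    moreover have "orthogonal (v - (\<Sum>b\<in>B. (v \<bullet> b) *\<^sub>R b)) c" if "c \<in> B" for c
      using that B(1) by (simp add: orthogonal_def inner_diff_left inner_sum_left orthonormal if_distrib cong: if_cong)
    ultimately have "orthogonal (v - (\<Sum>b\<in>B. (v \<bullet> b) *\<^sub>R b)) (v - (\<Sum>b\<in>B. (v \<bullet> b) *\<^sub>R b))"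
      using orthogonal_to_span by blast
    then show ?thesis by (simp add: orthogonal_self)
  qed
  with B orthonormal show thesis
    using that by blast
qed

section \<open>Dimension count for the signs of a quadratic form\<close>

text \<open>Otherwise at most \<open>DIM('a)\<close> linear conditions on a pair (v, c) have a
  nonzero solution: A_i . v + c = 0 at the positive weights, and \<open>v\<close> orthogonal to each
  \<open>b\<close> with \<open>ev b < 0\<close>. The two expressions of the form then make the
  affine function vanish at every A_i, and \<open>span\<close> and \<open>J_ne\<close> give v = 0
  and c = 0.\<close>

lemma diagonal_form_index_bound:
  fixes A :: "'b \<Rightarrow> 'a::euclidean_space"
  assumes J: "finite J" "\<And>i. i \<in> J \<Longrightarrow> \<alpha> i \<noteq> 0"
    and zero: "(\<Sum>i\<in>J. \<alpha> i) = 0" "(\<Sum>i\<in>J. \<alpha> i *\<^sub>R A i) = 0"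
    and span: "\<And>v c. (\<forall>i\<in>J. A i \<bullet> v + c = 0) \<Longrightarrow> v = 0"
    and J_ne: "J \<noteq> {}"
    and B: "finite B"
    and form: "\<And>v. (\<Sum>i\<in>J. \<alpha> i * (A i \<bullet> v)\<^sup>2) = (\<Sum>b\<in>B. ev b * (v \<bullet> b)\<^sup>2)"
  shows "DIM('a) + 1 \<le> card {i\<in>J. \<alpha> i > 0} + card {b\<in>B. ev b < 0}"
proof (rule ccontr)
  assume less: "\<not> ?thesis"
  \<comment> \<open>A vector orthogonal to T makes the form nonnegative through B and nonpositive through J.\<close>
  define T where "T = (\<lambda>i. (A i, 1::real)) ` {i\<in>J. \<alpha> i > 0} \<union> (\<lambda>b. (b, 0)) ` {b\<in>B. ev b < 0}"
  have "dim T \<le> card T"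
    using J(1) B by (intro dim_le_card') (simp add: T_def)
  also have "card T \<le> card {i\<in>J. \<alpha> i > 0} + card {b\<in>B. ev b < 0}"
    unfolding T_def using J(1) B by (intro card_Un_le[THEN order_trans] add_mono card_image_le) auto
  finally have "dim T < DIM('a \<times> real)"
    using less by simp
  then obtain y where y: "y \<noteq> 0" "\<And>t. t \<in> span T \<Longrightarrow> orthogonal y t"
    using orthogonal_to_subspace_exists by blast
  obtain v c where vc: "y = (v, c)"
    by (cases y)
  have orth: "y \<bullet> t = 0" if "t \<in> T" for t
    using y(2)[OF span_base[OF that]] by (simp add: orthogonal_def)
  have pos: "A i \<bullet> v + c = 0" if "i \<in> J" "\<alpha> i > 0" for i
    using orth[of "(A i, 1)"] that by (simp add: T_def vc inner_commute)
  have neg: "v \<bullet> b = 0" if "b \<in> B" "ev b < 0" for b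
    using orth[of "(b, 0)"] that by (simp add: T_def vc)
  have "0 \<le> (\<Sum>b\<in>B. ev b * (v \<bullet> b)\<^sup>2)"
    using neg by (intro sum_nonneg) (metis mult_nonneg_nonneg not_le power_zero_numeral mult_zero_right order_refl zero_le_power2)
  \<comment> \<open>Both added terms vanish by \<open>zero\<close>; they complete the squares of A_i
    . v + c.\<close>
  also have "\<dots> = (\<Sum>i\<in>J. \<alpha> i * (A i \<bullet> v)\<^sup>2) + 2 * c * ((\<Sum>i\<in>J. \<alpha> i *\<^sub>R A i) \<bullet> v) + c\<^sup>2 * (\<Sum>i\<in>J. \<alpha> i)"
    by (simp add: zero form)
  also have "\<dots> = (\<Sum>i\<in>J. \<alpha> i * (A i \<bullet> v + c)\<^sup>2)"
    by (simp add: inner_sum_left sum_distrib_left flip: sum.distrib) (simp add: power2_eq_square algebra_simps)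
  finally have ge: "(\<Sum>i\<in>J. - \<alpha> i * (A i \<bullet> v + c)\<^sup>2) \<le> 0"
    by (simp add: sum_negf)
  have terms: "0 \<le> - \<alpha> i * (A i \<bullet> v + c)\<^sup>2" if "i \<in> J" for i
    using pos[OF that] by (cases "\<alpha> i > 0") (auto intro: mult_nonpos_nonneg)
  have "\<forall>i\<in>J. - \<alpha> i * (A i \<bullet> v + c)\<^sup>2 = 0"
    using ge terms sum_nonneg[of J "\<lambda>i. - \<alpha> i * (A i \<bullet> v + c)\<^sup>2"]
    by (subst sum_nonneg_eq_0_iff[OF J(1), symmetric]) (auto intro: antisym)
  then have vanish: "\<forall>i\<in>J. A i \<bullet> v + c = 0"
    using J(2) by auto
  then have "v = 0"
    by (rule span)
  with vanish J_ne have "c = 0"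
    by auto
  with \<open>v = 0\<close> y(1) vc show False
    by (simp add: zero_prod_def)
qed

text \<open>The set {x. v . x = - c} contains the affine hull, hence the whole space; its points 0
  and \<open>v\<close> give c = 0 and v . v = 0.\<close>

lemma affine_hull_UNIV_imp_zero:
  fixes v :: "'a::euclidean_space"
  assumes "affine hull S = UNIV" "\<And>a. a \<in> S \<Longrightarrow> a \<bullet> v + c = 0"
  shows "v = 0"
proof -
  have "affine hull S \<subseteq> {x. v \<bullet> x = - c}"
    using assms(2) by (intro hull_minimal affine_hyperplane) (auto simp: inner_commute add_eq_0_iff2)
  then have "v \<bullet> x = - c" for x
    using assms(1) by auto
  from this[of 0] this[of v] show ?thesis by simp
qed

section \<open>Root multiplicities of products of linear factors\<close>

lemma order_prod_linear:
  fixes r :: "'b \<Rightarrow> 'a::idom"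
  assumes "finite B"
  shows "Polynomial.order x (\<Prod>b\<in>B. [:- r b, 1:]) = card {b\<in>B. r b = x}"
  using assms
proof (induction B rule: finite_induct)
  case (insert b B)
  have ord: "Polynomial.order x [:- r b, 1:] = (if r b = x then 1 else 0)"
    using order_power_n_n[of x 1] by (auto intro: order_0I)
  have "Polynomial.order x (\<Prod>b\<in>insert b B. [:- r b, 1:])
      = (if r b = x then 1 else 0) + card {b\<in>B. r b = x}"
    using insert by (simp add: order_mult ord del: mult_pCons_left)
  also have "\<dots> = card {c\<in>insert b B. r c = x}"
  proof -
    have "{c\<in>insert b B. r c = x} = (if r b = x then insert b {c\<in>B. r c = x} else {c\<in>B. r c = x})"
      by auto
    then show ?thesis using insert by simp
  qed
  finally show ?case .
qed simp

text \<open>Carries a real linear factorization over to the complex numbers, where it shows that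
  every complex root is real.\<close>

lemma map_poly_of_real_prod_linear:
  fixes r :: "'b \<Rightarrow> real"
  shows "map_poly of_real (\<Prod>b\<in>B. [:- r b, 1:])
    = (\<Prod>b\<in>B. [:- of_real (r b), 1:] :: 'a::{real_algebra_1, comm_ring_1} poly)"
proof (induction B rule: infinite_finite_induct)
  case (insert b B)
  have "map_poly of_real ([:- r b, 1:] * q) = [:- of_real (r b), 1:] * (map_poly of_real q :: 'a poly)" for q
    by (rule poly_eqI) (simp add: coeff_map_poly coeff_pCons split: nat.split)
  then show ?case
    using insert by (simp del: mult_pCons_left)
qed simp_all

text \<open>The order at \<open>x\<close> is the size of the fibre of \<open>r\<close> over
  \<open>x\<close>; the fibres over the roots satisfying \<open>R\<close> partition the indices
  counted on the right. \<open>R\<close> will be a sign condition.\<close>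

lemma sum_order_prod_linear:
  fixes r :: "'b \<Rightarrow> 'a::idom"
  assumes B: "finite B"
  shows "(\<Sum>x | poly (\<Prod>b\<in>B. [:- r b, 1:]) x = 0 \<and> R x. Polynomial.order x (\<Prod>b\<in>B. [:- r b, 1:]))
    = card {b\<in>B. R (r b)}"
proof -
  have "{x. poly (\<Prod>b\<in>B. [:- r b, 1:]) x = 0 \<and> R x} = r ` {b\<in>B. R (r b)}"
    using B by (auto simp: poly_prod)
  then have "(\<Sum>x | poly (\<Prod>b\<in>B. [:- r b, 1:]) x = 0 \<and> R x. Polynomial.order x (\<Prod>b\<in>B. [:- r b, 1:]))
      = (\<Sum>x\<in>r ` {b\<in>B. R (r b)}. \<Sum>b | b \<in> {b\<in>B. R (r b)} \<and> r b = x. 1)"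
    using B by (auto simp: order_prod_linear intro!: sum.cong arg_cong[of _ _ card])
  also have "\<dots> = card {b\<in>B. R (r b)}"
    using B by (subst sum.image_gen[symmetric]) auto
  finally show ?thesis .
qed

section \<open>Characteristic polynomial of a weighted Gram matrix\<close>

text \<open>The matrix is a diagonal shift of -M, and the signs of the entries collect to (-1)^k in
  each k-minor. The inner Leibniz sums are the principal minors.\<close>

lemma det_char_matrix_principal_minors:
  fixes M :: "'b \<Rightarrow> 'b \<Rightarrow> 'a::comm_ring_1"
  assumes "distinct xs"
  shows "Determinant.det (x \<cdot>\<^sub>m 1\<^sub>m (length xs) - mat (length xs) (length xs) (\<lambda>(i, j). M (xs ! i) (xs ! j)))
    = (\<Sum>I\<in>Pow (set xs). x ^ (length xs - card I) * ((- 1) ^ card I *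
        (\<Sum>p | p permutes I. of_int (sign p) * (\<Prod>i\<in>I. M i (p i)))))"
proof -
  have "x \<cdot>\<^sub>m 1\<^sub>m (length xs) - mat (length xs) (length xs) (\<lambda>(i, j). M (xs ! i) (xs ! j))
      = mat (length xs) (length xs) (\<lambda>(i, j). - M (xs ! i) (xs ! j) + (if xs ! j = xs ! i then x else 0))"
    by (rule eq_matI) (auto simp: nth_eq_iff_index_eq[OF assms])
  then have "Determinant.det (x \<cdot>\<^sub>m 1\<^sub>m (length xs) - mat (length xs) (length xs) (\<lambda>(i, j). M (xs ! i) (xs ! j)))
    = (\<Sum>p | p permutes set xs. of_int (sign p) * (\<Prod>i\<in>set xs. - M i (p i) + (if p i = i then x else 0)))"
    using det_mat_nth_leibniz[OF assms, of "\<lambda>i j. - M i j + (if j = i then x else 0)"] by simp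
  also have "\<dots> = (\<Sum>I\<in>Pow (set xs). x ^ (length xs - card I) *
        (\<Sum>p | p permutes I. of_int (sign p) * (\<Prod>i\<in>I. - M i (p i))))"
    using leibniz_sum_plus_diagonal[of "set xs" "\<lambda>i j. - M i j" x] distinct_card[OF assms] by simp
  finally show ?thesis
    by (simp add: prod_uminus sum_distrib_left mult_ac)
qed

lemma det_diagonal_mat:
  fixes d :: "nat \<Rightarrow> 'a::comm_ring_1"
  shows "Determinant.det (mat n n (\<lambda>(i, j). if i = j then d i else 0)) = (\<Prod>i<n. d i)"
  by (subst det_upper_triangular[of _ n]) (auto simp: prod_list_diag_prod lessThan_atLeast0 intro!: upper_triangularI)

text \<open>The matrix with entries \<alpha>_i (X_i . Y_j) factors as \<open>U * V\<close> through
  coordinates along \<open>B\<close>, and \<open>diag\<close> makes \<open>V * U\<close> diagonal,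
  so Sylvester's identity applies. \<open>X\<close> and \<open>Y\<close> are separate families to
  allow two base points.\<close>

lemma principal_minors_weighted_gram:
  fixes X Y :: "'b \<Rightarrow> 'a::euclidean_space"
  assumes J: "finite J" and B: "finite B"
    and expand: "\<And>v w. v \<bullet> w = (\<Sum>b\<in>B. (v \<bullet> b) * (w \<bullet> b))"
    and diag: "\<And>b c. b \<in> B \<Longrightarrow> c \<in> B \<Longrightarrow>
      (\<Sum>i\<in>J. \<alpha> i * ((X i \<bullet> b) * (Y i \<bullet> c))) = (if b = c then ev b else 0)"
  shows "x ^ card B * (\<Sum>I\<in>Pow J. x ^ (card J - card I) * ((- 1) ^ card I *
        (\<Sum>p | p permutes I. of_int (sign p) * (\<Prod>i\<in>I. \<alpha> i * (X i \<bullet> Y (p i))))))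
    = x ^ card J * (\<Prod>b\<in>B. x - ev b)"
proof -
  obtain xs where xs: "set xs = J" "distinct xs"
    using finite_distinct_list[OF J] by blast
  obtain bs where bs: "set bs = B" "distinct bs"
    using finite_distinct_list[OF B] by blast
  have len: "length xs = card J" "length bs = card B"
    using distinct_card xs bs by metis+
  have sum_xs: "(\<Sum>i\<in>{0..<length xs}. g (xs ! i)) = (\<Sum>i\<in>J. g i)" for g :: "'b \<Rightarrow> real"
    using sum.reindex_bij_betw[OF bij_betw_nth[OF xs(2) refl refl], of g] xs(1) by (simp add: lessThan_atLeast0)
  have sum_bs: "(\<Sum>i\<in>{0..<length bs}. g (bs ! i)) = (\<Sum>b\<in>B. g b)" for g :: "'a \<Rightarrow> real"
    using sum.reindex_bij_betw[OF bij_betw_nth[OF bs(2) refl refl], of g] bs(1) by (simp add: lessThan_atLeast0)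
  have prod_bs: "(\<Prod>i<length bs. g (bs ! i)) = (\<Prod>b\<in>B. g b)" for g :: "'a \<Rightarrow> real"
    using prod.reindex_bij_betw[OF bij_betw_nth[OF bs(2) refl refl], of g] bs(1) by simp
  define U where "U = mat (length xs) (length bs) (\<lambda>(i, l). \<alpha> (xs ! i) * (X (xs ! i) \<bullet> bs ! l))"
  define V where "V = mat (length bs) (length xs) (\<lambda>(l, i). Y (xs ! i) \<bullet> bs ! l)"
  have UV: "U * V = mat (length xs) (length xs) (\<lambda>(i, j). \<alpha> (xs ! i) * (X (xs ! i) \<bullet> Y (xs ! j)))"
  proof (rule eq_matI)
    fix i j
    assume "i < dim_row (mat (length xs) (length xs) (\<lambda>(i, j). \<alpha> (xs ! i) * (X (xs ! i) \<bullet> Y (xs ! j))))"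
      and "j < dim_col (mat (length xs) (length xs) (\<lambda>(i, j). \<alpha> (xs ! i) * (X (xs ! i) \<bullet> Y (xs ! j))))"
    then show "(U * V) $$ (i, j) = mat (length xs) (length xs) (\<lambda>(i, j). \<alpha> (xs ! i) * (X (xs ! i) \<bullet> Y (xs ! j))) $$ (i, j)"
      using sum_bs[of "\<lambda>b. \<alpha> (xs ! i) * (X (xs ! i) \<bullet> b) * (Y (xs ! j) \<bullet> b)"]
      by (simp add: U_def V_def scalar_prod_def expand[of "X _" "Y _"] sum_distrib_left mult.assoc)
  qed (simp_all add: U_def V_def)
  have VU: "V * U = mat (length bs) (length bs) (\<lambda>(l, m). if l = m then ev (bs ! l) else 0)"
  proof (rule eq_matI)
    fix l m
    assume "l < dim_row (mat (length bs) (length bs) (\<lambda>(l, m). if l = m then ev (bs ! l) else 0))"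
      and "m < dim_col (mat (length bs) (length bs) (\<lambda>(l, m). if l = m then ev (bs ! l) else 0))"
    then have lm: "l < length bs" "m < length bs" by simp_all
    then have "bs ! l \<in> B" "bs ! m \<in> B" "bs ! m = bs ! l \<longleftrightarrow> l = m"
      using bs by (auto simp: nth_eq_iff_index_eq)
    \<comment> \<open>Row \<open>l\<close> comes from \<open>Y\<close> and column \<open>m\<close>
      from \<open>X\<close>, so \<open>diag\<close> is taken with the two basis vectors
      swapped.\<close>
    then show "(V * U) $$ (l, m) = mat (length bs) (length bs) (\<lambda>(l, m). if l = m then ev (bs ! l) else 0) $$ (l, m)"
      using lm diag[of "bs ! m" "bs ! l"] sum_xs[of "\<lambda>i. (Y i \<bullet> bs ! l) * (\<alpha> i * (X i \<bullet> bs ! m))"]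
      by (simp add: U_def V_def scalar_prod_def mult_ac)
  qed (simp_all add: U_def V_def)
  have "x \<cdot>\<^sub>m 1\<^sub>m (length bs) - V * U = mat (length bs) (length bs) (\<lambda>(l, m). if l = m then x - ev (bs ! l) else 0)"
    unfolding VU by (rule eq_matI) auto
  then have "Determinant.det (x \<cdot>\<^sub>m 1\<^sub>m (length bs) - V * U) = (\<Prod>b\<in>B. x - ev b)"
    using prod_bs[of "\<lambda>b. x - ev b"] by (simp add: det_diagonal_mat)
  moreover have "U \<in> carrier_mat (length xs) (length bs)" "V \<in> carrier_mat (length bs) (length xs)"
    by (simp_all add: U_def V_def)
  note sylvester_det_identity[OF this, of x]
  ultimately show ?thesis
    unfolding UV det_char_matrix_principal_minors[OF xs(2), of x "\<lambda>i j. \<alpha> i * (X i \<bullet> Y j)"]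
    by (simp add: len xs(1))
qed

section \<open>The invariants as sums of principal minors\<close>

text \<open>Multiplying row \<open>i\<close> by \<alpha>_i turns the Gram determinant into the
  principal minor on \<open>I\<close> of the matrix with entries \<alpha>_i (A_i - P) . (A_j -
  Q).\<close>

lemma weighted_simplex_det:
  assumes "finite I"
  shows "(\<Prod>i\<in>I. \<alpha> i) * simplex_det A P Q I
    = (\<Sum>p | p permutes I. of_int (sign p) * (\<Prod>i\<in>I. \<alpha> i * ((A i - P) \<bullet> (A (p i) - Q))))"
proof -
  let ?xs = "sorted_list_of_set I"
  have "mat (card I) (card I) (\<lambda>(i, j). (map A ?xs ! i - P) \<bullet> (map A ?xs ! j - Q))
      = mat (length ?xs) (length ?xs) (\<lambda>(i, j). (A (?xs ! i) - P) \<bullet> (A (?xs ! j) - Q))"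
    by (rule eq_matI) auto
  then have "simplex_det A P Q I
      = (\<Sum>p | p permutes I. of_int (sign p) * (\<Prod>i\<in>I. (A i - P) \<bullet> (A (p i) - Q)))"
    unfolding simplex_det_def Let_def
    using det_mat_nth_leibniz[of ?xs "\<lambda>i j. (A i - P) \<bullet> (A j - Q)"] assms by simp
  then show ?thesis
    by (simp add: sum_distrib_left prod.distrib mult_ac)
qed

text \<open>The convention c_0 = 1 agrees with the general sum, since the empty product and the 0 x
  0 determinant are both 1.\<close>

lemma sum_weighted_simplex_det:
  fixes A :: "nat \<Rightarrow> real^'n"
  shows "(\<Sum>I | I \<subseteq> {1..CARD('n) + 2} \<and> card I = k. (\<Prod>i\<in>I. \<alpha> i) * simplex_det A P Q I)
    = invariant_c A \<alpha> P Q k"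
proof (cases "k = 0")
  case True
  \<comment> \<open>\<open>card\<close> is 0 on infinite sets too; the finite bound rules them
    out.\<close>
  have "I \<subseteq> {1..CARD('n) + 2} \<and> card I = 0 \<longleftrightarrow> I = {}" for I
    using finite_subset by fastforce
  then show ?thesis
    using True by (simp add: invariant_c_def simplex_det_def)
qed (simp add: invariant_c_def)

text \<open>Minors of equal size add up to one invariant. Sizes up to n + 1 make up x f(x); size n +
  2 gives the constant term, which is not part of f.\<close>

lemma sum_minors_eq_characteristic_polynomial:
  fixes A :: "nat \<Rightarrow> real^'n"
  defines "J \<equiv> {1..CARD('n) + 2}"
  shows "(\<Sum>I\<in>Pow J. x ^ (card J - card I) * ((- 1) ^ card I *
        ((\<Prod>i\<in>I. \<alpha> i) * simplex_det A P Q I)))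
    = poly ([:(- 1) ^ card J * invariant_c A \<alpha> P Q (card J):] + [:0, 1:] * characteristic_polynomial A \<alpha> P Q) x"
proof -
  have J: "finite J" "card J = CARD('n) + 2"
    by (simp_all add: J_def)
  have "(\<Sum>I\<in>Pow J. x ^ (card J - card I) * ((- 1) ^ card I * ((\<Prod>i\<in>I. \<alpha> i) * simplex_det A P Q I)))
    = (\<Sum>k\<le>card J. \<Sum>I\<in>{I \<in> Pow J. card I = k}. x ^ (card J - card I) * ((- 1) ^ card I *
        ((\<Prod>i\<in>I. \<alpha> i) * simplex_det A P Q I)))"
    using J(1) by (intro sum.group[symmetric]) (auto intro: card_mono)
  also have "\<dots> = (\<Sum>k\<le>card J. x ^ (card J - k) * ((- 1) ^ k * invariant_c A \<alpha> P Q k))"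
    unfolding sum_weighted_simplex_det[symmetric]
    by (intro sum.cong refl) (simp add: sum_distrib_left J_def)
  \<comment> \<open>The top size k = n + 2 carries x^0; for smaller k, n + 2 - k = 1 + (n + 1 - k)
    yields the common factor x.\<close>
  also have "{..card J} = insert (card J) {0..CARD('n) + 1}"
    using J(2) by auto
  also have "(\<Sum>k\<in>\<dots>. x ^ (card J - k) * ((- 1) ^ k * invariant_c A \<alpha> P Q k))
      = (- 1) ^ card J * invariant_c A \<alpha> P Q (card J)
        + x * (\<Sum>k = 0..CARD('n) + 1. (- 1) ^ k * invariant_c A \<alpha> P Q k * x ^ (CARD('n) + 1 - k))"
    unfolding sum_distrib_left using J(2)
    by (subst sum.insert) (auto simp: Suc_diff_le mult_ac simp del: sum.cl_ivl_Suc intro!: sum.cong)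
  finally show ?thesis
    by (simp add: characteristic_polynomial_def poly_sum poly_monom)
qed

section \<open>Factorization over the eigenvalues\<close>

text \<open>The diagonalised form is returned together with the factorization because the sign count
  must refer to the same \<open>B\<close> and \<open>ev\<close>.\<close>

lemma characteristic_polynomial_factorization:
  fixes A :: "nat \<Rightarrow> real^'n" and P Q :: "real^'n"
  defines "J \<equiv> {1..CARD('n) + 2}"
  assumes zero: "(\<Sum>i\<in>J. \<alpha> i) = 0" "(\<Sum>i\<in>J. \<alpha> i *\<^sub>R A i) = 0"
  obtains B :: "(real^'n) set" and ev where "finite B" "card B = CARD('n)"
    "\<And>v. (\<Sum>i\<in>J. \<alpha> i * (A i \<bullet> v)\<^sup>2) = (\<Sum>b\<in>B. ev b * (v \<bullet> b)\<^sup>2)"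
    "characteristic_polynomial A \<alpha> P Q = [:0, 1:] * (\<Prod>b\<in>B. [:- ev b, 1:])"
proof -
  define S where "S v = (\<Sum>i\<in>J. (\<alpha> i * (A i \<bullet> v)) *\<^sub>R A i)" for v
  have S: "linear S"
    by (rule linearI)
       (simp_all add: S_def inner_simps algebra_simps sum.distrib scaleR_sum_right)
  have inner_S: "v \<bullet> S w = (\<Sum>i\<in>J. \<alpha> i * ((A i \<bullet> v) * (A i \<bullet> w)))" for v w
    by (simp add: S_def inner_sum_right inner_commute mult_ac)
  have adj: "S v \<bullet> w = v \<bullet> S w" for v w
    by (subst inner_commute) (simp add: inner_S mult_ac)
  obtain B ev where B: "finite B" "card B = DIM(real^'n)"
      and orthonormal: "\<And>b c. b \<in> B \<Longrightarrow> c \<in> B \<Longrightarrow> b \<bullet> c = (if b = c then 1 else 0)"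
      and eig: "\<And>b. b \<in> B \<Longrightarrow> S b = ev b *\<^sub>R b"
      and expand: "\<And>v. (\<Sum>b\<in>B. (v \<bullet> b) *\<^sub>R b) = v"
    using selfadjoint_eigenbasis[OF S adj] by blast
  have parseval: "v \<bullet> w = (\<Sum>b\<in>B. (v \<bullet> b) * (w \<bullet> b))" for v w
  proof -
    have "v \<bullet> w = (\<Sum>b\<in>B. (v \<bullet> b) *\<^sub>R b) \<bullet> w"
      by (simp only: expand)
    also have "\<dots> = (\<Sum>b\<in>B. (v \<bullet> b) * (w \<bullet> b))"
      by (simp only: inner_sum_left inner_scaleR_left inner_commute[of w])
    finally show ?thesis .
  qed
  have form: "(\<Sum>i\<in>J. \<alpha> i * (A i \<bullet> v)\<^sup>2) = (\<Sum>b\<in>B. ev b * (v \<bullet> b)\<^sup>2)" for v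
  proof -
    have "(\<Sum>i\<in>J. \<alpha> i * (A i \<bullet> v)\<^sup>2) = v \<bullet> S v"
      by (simp add: inner_S power2_eq_square)
    also have "\<dots> = (\<Sum>b\<in>B. (v \<bullet> b) * (v \<bullet> S b))"
      by (subst parseval) (simp add: adj)
    also have "\<dots> = (\<Sum>b\<in>B. ev b * (v \<bullet> b)\<^sup>2)"
      by (intro sum.cong refl) (simp add: eig power2_eq_square)
    finally show ?thesis .
  qed
  have diag: "(\<Sum>i\<in>J. \<alpha> i * (((A i - P) \<bullet> b) * ((A i - Q) \<bullet> c))) = (if b = c then ev b else 0)"
    if "b \<in> B" "c \<in> B" for b c
  proof -
    \<comment> \<open>Every term containing \<open>P\<close> or \<open>Q\<close> has one of the two
      vanishing sums as a factor, so the base points disappear.\<close>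
    have "(\<Sum>i\<in>J. \<alpha> i * (((A i - P) \<bullet> b) * ((A i - Q) \<bullet> c)))
      = (\<Sum>i\<in>J. \<alpha> i * ((A i \<bullet> c) * (A i \<bullet> b))) - (P \<bullet> b) * ((\<Sum>i\<in>J. \<alpha> i *\<^sub>R A i) \<bullet> c)
        - (Q \<bullet> c) * ((\<Sum>i\<in>J. \<alpha> i *\<^sub>R A i) \<bullet> b) + (P \<bullet> b) * (Q \<bullet> c) * (\<Sum>i\<in>J. \<alpha> i)"
      by (simp add: inner_sum_left sum_distrib_left flip: sum.distrib sum_subtractf)
         (simp add: inner_diff_left algebra_simps)
    also have "\<dots> = c \<bullet> S b"
      by (simp add: zero inner_S)
    also have "\<dots> = (if b = c then ev b else 0)"
      using that orthonormal[of c b] by (simp add: eig)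
    finally show ?thesis .
  qed
  define g where "g = (\<Prod>b\<in>B. [:- ev b, 1:])"
  let ?f = "characteristic_polynomial A \<alpha> P Q"
  \<comment> \<open>The constant term of the characteristic polynomial: the signed determinant of
    the full matrix of size n + 2.\<close>
  let ?c = "(- 1) ^ card J * invariant_c A \<alpha> P Q (card J)"
  have J: "finite J" "card J = CARD('n) + 2"
    by (simp_all add: J_def)
  have B': "card B = CARD('n)"
    using B(2) by simp
  \<comment> \<open>The factor x^n comes from Sylvester's identity; splitting x^(n + 2) as x^n x^2
    lets it cancel between polynomials.\<close>
  have "monom 1 (CARD('n)) * ([:?c:] + [:0, 1:] * ?f) = monom 1 (CARD('n)) * ([:0, 0, 1:] * g)"
  proof (rule poly_ext)
    fix x :: real
    have "poly ([:?c:] + [:0, 1:] * ?f) x = (\<Sum>I\<in>Pow J. x ^ (card J - card I) * ((- 1) ^ card I *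
        ((\<Prod>i\<in>I. \<alpha> i) * simplex_det A P Q I)))"
      unfolding J_def by (rule sum_minors_eq_characteristic_polynomial[symmetric])
    also have "\<dots> = (\<Sum>I\<in>Pow J. x ^ (card J - card I) * ((- 1) ^ card I *
        (\<Sum>p | p permutes I. of_int (sign p) * (\<Prod>i\<in>I. \<alpha> i * ((A i - P) \<bullet> (A (p i) - Q))))))"
      by (intro sum.cong refl) (simp only: weighted_simplex_det[OF finite_subset[OF _ J(1)]] Pow_iff)
    finally have "x ^ card B * poly ([:?c:] + [:0, 1:] * ?f) x = x ^ card J * (\<Prod>b\<in>B. x - ev b)"
      using principal_minors_weighted_gram[OF J(1) B(1) parseval diag, of x] by (simp only:)
    moreover have "poly ([:0, 0, 1:] * g) x = x\<^sup>2 * (\<Prod>b\<in>B. x - ev b)"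
      by (simp add: g_def poly_prod power2_eq_square)
    moreover have "x ^ card J = x ^ CARD('n) * x\<^sup>2"
      by (simp only: J(2) power_add)
    ultimately show "poly (monom 1 (CARD('n)) * ([:?c:] + [:0, 1:] * ?f)) x = poly (monom 1 (CARD('n)) * ([:0, 0, 1:] * g)) x"
      by (simp only: poly_mult[of "monom _ _"] poly_monom mult_1_left B' mult.assoc)
  qed
  then have *: "[:?c:] + [:0, 1:] * ?f = [:0, 0, 1:] * g"
    by (subst (asm) mult_cancel_left) (simp add: monom_eq_0_iff)
  \<comment> \<open>The right side is divisible by x, so evaluation at 0 isolates
    \<open>?c\<close>.\<close>
  from arg_cong[OF *, of "\<lambda>p. poly p 0"] have "?c = 0"
    by simp
  with * have "[:0, 1:] * ?f = [:0, 1:] * ([:0, 1:] * g)"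
    by simp
  then have "?f = [:0, 1:] * g"
    by (subst (asm) mult_cancel_left) simp
  with B(1) B' form show thesis
    using that unfolding g_def by blast
qed

section \<open>Reality and signs of the roots\<close>

theorem theorem3p4:
  fixes A :: "nat \<Rightarrow> real^'n" and \<alpha> :: "nat \<Rightarrow> real" and P Q :: "real^'n" and s :: nat
  assumes "any_affinely_independent A"
    and "\<forall>i\<in>{1..CARD('n) + 2}. \<alpha> i \<noteq> 0"
    and "(\<Sum>i = 1..CARD('n) + 2. \<alpha> i) = 0"
    and "(\<Sum>i = 1..CARD('n) + 2. \<alpha> i *\<^sub>R A i) = 0"
  defines "f \<equiv> characteristic_polynomial A \<alpha> P Q"
  shows "(\<forall>z::complex. poly (map_poly of_real f) z = 0 \<longrightarrow> z \<in> \<real>) \<and>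
         (card {i \<in> {1..CARD('n) + 2}. \<alpha> i > 0} = s \<longrightarrow>
            Polynomial.order 0 f = 1 \<and>
            (\<Sum>x | poly f x = 0 \<and> x > 0. Polynomial.order x f) = s - 1 \<and>
            (\<Sum>x | poly f x = 0 \<and> x < 0. Polynomial.order x f) = CARD('n) + 1 - s)"
proof -
  let ?J = "{1..CARD('n) + 2}"
  have J: "finite ?J" "card ?J = CARD('n) + 2" "?J \<noteq> {}"
    by simp_all
  obtain B ev where B: "finite B" "card B = CARD('n)"
    and form: "\<And>v. (\<Sum>i\<in>?J. \<alpha> i * (A i \<bullet> v)\<^sup>2) = (\<Sum>b\<in>B. ev b * (v \<bullet> b)\<^sup>2)"
    and f_eq: "f = [:0, 1:] * (\<Prod>b\<in>B. [:- ev b, 1:])"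
    using characteristic_polynomial_factorization[OF assms(3,4), of P Q] unfolding f_def by blast
  define g where "g = (\<Prod>b\<in>B. [:- ev b, 1:])"
  have g: "g \<noteq> 0"
    using B(1) by (simp add: g_def)
  have f: "f = [:0, 1:] * g"
    by (simp add: f_eq g_def)

  have "z \<in> \<real>" if "poly (map_poly of_real f) z = 0" for z :: complex
  proof -
    have "map_poly of_real f = [:0, 1:] * (\<Prod>b\<in>B. [:- of_real (ev b), 1:] :: complex poly)"
      unfolding f_eq by (simp add: map_poly_pCons map_poly_of_real_prod_linear)
    then have "z * (\<Prod>b\<in>B. z - of_real (ev b)) = 0"
      using that by (simp add: poly_prod)
    then show ?thesis
      using B(1) by auto
  qed
  moreover have "Polynomial.order 0 f = 1 \<and>
      (\<Sum>x | poly f x = 0 \<and> x > 0. Polynomial.order x f) = s - 1 \<and>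
      (\<Sum>x | poly f x = 0 \<and> x < 0. Polynomial.order x f) = CARD('n) + 1 - s"
    if s: "card {i \<in> ?J. \<alpha> i > 0} = s"
  proof -
    \<comment> \<open>The first n + 1 points are affinely independent, hence already span the space
      affinely.\<close>
    have spanning: "v = 0" if "\<forall>i\<in>?J. A i \<bullet> v + c = 0" for v c
    proof (rule affine_hull_UNIV_imp_zero)
      let ?I = "{1..CARD('n) + 1}"
      have "inj_on A ?I" "\<not> affine_dependent (A ` ?I)"
        using assms(1)[unfolded any_affinely_independent_def, rule_format, of ?I] by auto
      then show "affine hull (A ` ?I) = UNIV"
        by (intro affine_independent_span_eq) (simp_all add: card_image)
      show "a \<bullet> v + c = 0" if "a \<in> A ` ?I" for a
        using that \<open>\<forall>i\<in>?J. A i \<bullet> v + c = 0\<close> by auto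
    qed
    have "DIM(real^'n) + 1 \<le> card {i\<in>?J. \<alpha> i > 0} + card {b\<in>B. ev b < 0}"
      by (rule diagonal_form_index_bound[OF J(1) _ assms(3,4) spanning J(3) B(1) form])
         (use assms(2) in auto)
    then have neg: "CARD('n) + 1 \<le> s + card {b\<in>B. ev b < 0}"
      using s by simp
    \<comment> \<open>Negating weights and eigenvalues preserves the hypotheses and bounds the
      number of positive eigenvalues.\<close>
    have "DIM(real^'n) + 1 \<le> card {i\<in>?J. - \<alpha> i > 0} + card {b\<in>B. - ev b < 0}"
      by (rule diagonal_form_index_bound[where A = A, OF J(1) _ _ _ spanning J(3) B(1)])
         (use assms(2-4) form in \<open>auto simp: sum_negf\<close>)
    then have pos: "CARD('n) + 1 \<le> card {i\<in>?J. \<alpha> i < 0} + card {b\<in>B. ev b > 0}"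
      by simp
    have "?J = {i\<in>?J. \<alpha> i > 0} \<union> {i\<in>?J. \<alpha> i < 0}"
      using assms(2) by (auto simp: linorder_neq_iff)
    then have "card ?J = s + card {i\<in>?J. \<alpha> i < 0}"
      using s by (metis (no_types, lifting) card_Un_disjoint J(1) disjoint_iff finite_Un mem_Collect_eq not_less_iff_gr_or_eq)
    moreover have "card B = card {b\<in>B. ev b = 0} + card {b\<in>B. ev b > 0} + card {b\<in>B. ev b < 0}"
    proof -
      have "B = {b\<in>B. ev b = 0} \<union> {b\<in>B. ev b > 0} \<union> {b\<in>B. ev b < 0}"
        by auto
      also have "card \<dots> = card {b\<in>B. ev b = 0} + card {b\<in>B. ev b > 0} + card {b\<in>B. ev b < 0}"
        using B(1) by (subst card_Un_disjoint; (subst card_Un_disjoint)?; fastforce)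
      finally show ?thesis .
    qed
    \<comment> \<open>There are n + 2 - s negative weights, so the bounds read: at least n + 1 - s
      negative and s - 1 positive eigenvalues. These add up to n, forcing equality. As neither count
      exceeds n, also 1 \<le> s \<le> n + 1, and no subtraction is truncated.\<close>
    ultimately have counts: "card {b\<in>B. ev b = 0} = 0" "card {b\<in>B. ev b > 0} = s - 1"
        "card {b\<in>B. ev b < 0} = CARD('n) + 1 - s"
      using neg pos J(2) B(2) by linarith+
    have order_f: "Polynomial.order x f = (if x = 0 then 1 else 0) + Polynomial.order x g" for x
    proof -
      have "Polynomial.order x [:0, 1:] = (if x = 0 then 1 else 0)"
        using order_power_n_n[of 0 1] by (auto intro: order_0I)
      then show ?thesis
        unfolding f using g by (subst order_mult) auto
    qed
    \<comment> \<open>A condition false at 0 excludes the only root of the extra factor x, so the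
      eigenvalues alone are counted.\<close>
    have nonzero: "(\<Sum>x | poly f x = 0 \<and> R x. Polynomial.order x f) = card {b\<in>B. R (ev b)}"
      if "\<not> R 0" for R
    proof -
      have "{x. poly f x = 0 \<and> R x} = {x. poly g x = 0 \<and> R x}"
        using that by (auto simp: f)
      moreover have "Polynomial.order x f = Polynomial.order x g" if "R x" for x
        using that \<open>\<not> R 0\<close> by (auto simp: order_f)
      ultimately show ?thesis
        using sum_order_prod_linear[OF B(1), of ev R] by (simp add: g_def)
    qed
    \<comment> \<open>Since no \<open>ev b\<close> is 0, the zero root comes from the factor x alone
      and is simple.\<close>
    show ?thesis
      using counts order_prod_linear[OF B(1), of 0 ev] order_f[of 0]
        nonzero[of "\<lambda>x. x > 0"] nonzero[of "\<lambda>x. x < 0"]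
      unfolding g_def[symmetric] by simp
  qed
  ultimately show ?thesis
    by blast
qed

end
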